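(* Let $n$ and $h$ be positive integers and put $m=\operatorname{lcm}(n,h)$. If a $\mathrm{BH}(\mathbb{Z}_n,h)$ matrix exists, then every prime divisor of $n$ which is self-conjugate modulo $m$ divides $h$.
   Context: For a finite abelian group $(G,+)$ and a positive integer $h$, a $\mathrm{BH}(G,h)$ matrix is a $|G|\times|G|$ matrix $H=(a_{g,k})_{g,k\in G}$ whose entries are complex $h$th roots of unity, which is $G$-invariant (i.e. $a_{g+l,k+l}=a_{g,k}$ for all $g,k,l\in G$), and satisfies $HH^*=|G|I$. $\mathbb{Z}_n$ is the cyclic group of order $n$. A prime $p$ is self-conjugate modulo a positive integer $N$ if, writing $N=p^aN'$ with $\gcd(p,N')=1$, there is an integer $j$ with $p^j\equiv -1\pmod{N'}$. *)

theory Defs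
  imports Complex_Main "HOL-Algebra.Elementary_Groups" "HOL-Number_Theory.Cong"
begin

text \<open>
  The group operation of \<open>HOL-Algebra\<close> is written multiplicatively, so \<open>g + l\<close> becomes
  \<open>g \<otimes>\<^bsub>G\<^esub> l\<close>. A matrix indexed by the group is a function of two arguments that matters only
  on the carrier; the last conjunct is the entrywise form of \<open>H H\<^sup>* = |G| I\<close>.
\<close>

definition BH_matrix :: "('a, 'b) monoid_scheme \<Rightarrow> nat \<Rightarrow> ('a \<Rightarrow> 'a \<Rightarrow> complex) \<Rightarrow> bool" where
  "BH_matrix G h H \<longleftrightarrow>
     comm_group G \<and> finite (carrier G) \<and>
     (\<forall>g\<in>carrier G. \<forall>k\<in>carrier G. H g k ^ h = 1) \<and>
     (\<forall>g\<in>carrier G. \<forall>k\<in>carrier G. \<forall>l\<in>carrier G.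
        H (g \<otimes>\<^bsub>G\<^esub> l) (k \<otimes>\<^bsub>G\<^esub> l) = H g k) \<and>
     (\<forall>g\<in>carrier G. \<forall>k\<in>carrier G.
        (\<Sum>l\<in>carrier G. H g l * cnj (H k l)) = (if g = k then of_nat (order G) else 0))"

text \<open>
  Only exponents \<open>j \<ge> 0\<close> are quantified over. A negative exponent, read as a power of an
  inverse of \<open>p\<close> modulo \<open>N'\<close>, gives nothing new, by the lemma below.
\<close>

definition self_conjugate :: "nat \<Rightarrow> nat \<Rightarrow> bool" where
  "self_conjugate p N \<longleftrightarrow>
     (\<exists>a N'. N = p ^ a * N' \<and> coprime p N' \<and> (\<exists>j::nat. [int p ^ j = - 1] (mod int N')))"

lemma inverse_power_cong_minus_one:
  fixes p q M :: int and j :: nat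
  assumes "[p * q = 1] (mod M)" and "[q ^ j = - 1] (mod M)"
  shows "[p ^ j = - 1] (mod M)"
proof -
  have "[(p * q) ^ j = 1] (mod M)"
    using cong_pow[OF assms(1), of j] by simp
  moreover have "[(p * q) ^ j = p ^ j * (- 1)] (mod M)"
    unfolding power_mult_distrib by (intro cong_mult cong_refl assms(2))
  ultimately have "[- (p ^ j) = 1] (mod M)"
    by (metis cong_sym cong_trans mult.right_neutral mult_minus_right)
  then show ?thesis
    by (metis cong_minus_minus_iff minus_minus)
qed

end

theory Submission
  imports Defs "Jordan_Normal_Form.Char_Poly"
begin

text \<open>
  Suppose \<open>p\<close> does not divide \<open>h\<close>, and write \<open>n = p ^ a * n'\<close> with \<open>p\<close> prime to \<open>n'\<close>. Let
  \<open>x\<^sub>0, \<dots>, x\<^bsub>n-1\<^esub>\<close> be the first column of the matrix. For every \<open>n\<close>-th root of unity \<open>\<alpha>\<close>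
  the character sum \<open>f \<alpha> = \<Sum> x\<^sub>g \<alpha> ^ g\<close> satisfies \<open>f \<alpha> * cnj (f \<alpha>) = n\<close>. Self-conjugacy says
  that a power of the Frobenius map acts as complex conjugation modulo \<open>p\<close> on the ring generated
  by the roots of unity of order prime to \<open>p\<close>, so there \<open>p dvd f 1 * cnj (f 1)\<close> forces
  \<open>p dvd f 1\<close> and hence \<open>p\<^sup>2 dvd n\<close>. With \<open>\<zeta>\<close> a primitive \<open>p ^ a\<close>-th root of unity and
  \<open>\<pi> = 1 - \<zeta>\<close>, the same congruence modulo \<open>\<pi>\<close> and descent on the power of \<open>\<pi>\<close> give \<open>\<pi> ^ e dvd f \<alpha>\<close>
  for all \<open>\<alpha>\<close>, where \<open>e = (p - 1) * p ^ (a - 1)\<close> is the ramification index of \<open>p\<close>. Averaging over the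
  \<open>n'\<close>-th roots of unity isolates \<open>\<Sum> y\<^sub>k \<zeta> ^ k\<close> with \<open>y\<^sub>k = x\<^bsub>kn'+r\<^esub>\<close>, and the independence of
  \<open>1, \<zeta>, \<dots>, \<zeta> ^ (e - 1)\<close> modulo \<open>\<pi> ^ e\<close> shows that \<open>y\<close> is periodic modulo \<open>p ^ (a - 1)\<close>, as
  distinct \<open>h\<close>-th roots of unity are incongruent modulo \<open>\<pi>\<close>. Then \<open>x\<close> has period \<open>n div p\<close>,
  contradicting the orthogonality of two rows.

  All congruences are checked on sums of roots of unity, so neither the irreducibility of cyclotomic
  polynomials nor Galois automorphisms are needed.
\<close>

section \<open>The ring of cyclotomic integers\<close>

text \<open>For \<open>m > 0\<close> this is the ring generated by the \<open>m\<close>-th roots of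
  unity. Presenting it as signed sums of single roots lets a property of all elements be proved by
  adding or subtracting one root at a time.\<close>

inductive_set cyclotomic_ints :: "nat \<Rightarrow> complex set" for m :: nat where
  zero: "0 \<in> cyclotomic_ints m"
| add_root: "x \<in> cyclotomic_ints m \<Longrightarrow> z ^ m = 1 \<Longrightarrow> x + z \<in> cyclotomic_ints m"
| diff_root: "x \<in> cyclotomic_ints m \<Longrightarrow> z ^ m = 1 \<Longrightarrow> x - z \<in> cyclotomic_ints m"

lemma cyclotomic_ints_root: "z ^ m = 1 \<Longrightarrow> z \<in> cyclotomic_ints m"
  using cyclotomic_ints.add_root[OF cyclotomic_ints.zero, of z m] by simp

lemma cyclotomic_ints_1: "1 \<in> cyclotomic_ints m"
  by (rule cyclotomic_ints_root) simp

lemma cyclotomic_ints_add: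
  assumes "x \<in> cyclotomic_ints m" "y \<in> cyclotomic_ints m"
  shows "x + y \<in> cyclotomic_ints m"
  using assms(2)
proof induction
  case zero
  then show ?case using assms(1) by simp
next
  case (add_root y z)
  then show ?case using cyclotomic_ints.add_root[of "x + y" m z] by (simp add: add.assoc)
next
  case (diff_root y z)
  then show ?case using cyclotomic_ints.diff_root[of "x + y" m z] by (simp add: add_diff_eq)
qed

lemma cyclotomic_ints_uminus: "x \<in> cyclotomic_ints m \<Longrightarrow> - x \<in> cyclotomic_ints m"
proof (induction rule: cyclotomic_ints.induct)
  case zero
  then show ?case by (simp add: cyclotomic_ints.zero)
next
  case (add_root x z)
  then show ?case using cyclotomic_ints.diff_root[of "- x" m z] by simp
next
  case (diff_root x z)
  then show ?case using cyclotomic_ints.add_root[of "- x" m z] by simp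
qed

lemma cyclotomic_ints_diff:
  "x \<in> cyclotomic_ints m \<Longrightarrow> y \<in> cyclotomic_ints m \<Longrightarrow> x - y \<in> cyclotomic_ints m"
  using cyclotomic_ints_add[of x m "- y"] cyclotomic_ints_uminus[of y m] by simp

lemma cyclotomic_ints_mult_root:
  "x \<in> cyclotomic_ints m \<Longrightarrow> w ^ m = 1 \<Longrightarrow> x * w \<in> cyclotomic_ints m"
proof (induction rule: cyclotomic_ints.induct)
  case zero
  then show ?case by (simp add: cyclotomic_ints.zero)
next
  case (add_root x z)
  then show ?case using cyclotomic_ints.add_root[of "x * w" m "z * w"]
    by (simp add: distrib_right power_mult_distrib)
next
  case (diff_root x z)
  then show ?case using cyclotomic_ints.diff_root[of "x * w" m "z * w"]
    by (simp add: left_diff_distrib power_mult_distrib)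
qed

lemma cyclotomic_ints_mult:
  assumes "x \<in> cyclotomic_ints m" "y \<in> cyclotomic_ints m"
  shows "x * y \<in> cyclotomic_ints m"
  using assms(2)
proof induction
  case zero
  then show ?case by (simp add: cyclotomic_ints.zero)
next
  case (add_root y z)
  then show ?case
    by (simp add: distrib_left cyclotomic_ints_add cyclotomic_ints_mult_root assms(1))
next
  case (diff_root y z)
  then show ?case
    by (simp add: right_diff_distrib cyclotomic_ints_diff cyclotomic_ints_mult_root assms(1))
qed

lemma cyclotomic_ints_power: "x \<in> cyclotomic_ints m \<Longrightarrow> x ^ k \<in> cyclotomic_ints m"
  by (induction k) (auto intro: cyclotomic_ints_1 cyclotomic_ints_mult)

lemma cyclotomic_ints_sum:
  "(\<And>i. i \<in> I \<Longrightarrow> f i \<in> cyclotomic_ints m) \<Longrightarrow> sum f I \<in> cyclotomic_ints m"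
  by (induction I rule: infinite_finite_induct)
     (auto intro: cyclotomic_ints.zero cyclotomic_ints_add)

lemma cyclotomic_ints_of_nat: "of_nat k \<in> cyclotomic_ints m"
  by (induction k) (auto intro: cyclotomic_ints.zero cyclotomic_ints_1 cyclotomic_ints_add)

lemma cyclotomic_ints_of_int: "of_int k \<in> cyclotomic_ints m"
  by (cases k rule: int_cases2)
     (auto simp: of_int_minus intro: cyclotomic_ints_uminus cyclotomic_ints_of_nat)

lemma cyclotomic_ints_cnj: "x \<in> cyclotomic_ints m \<Longrightarrow> cnj x \<in> cyclotomic_ints m"
proof (induction rule: cyclotomic_ints.induct)
  case zero
  then show ?case by (simp add: cyclotomic_ints.zero)
next
  case (add_root x z)
  then show ?case using cyclotomic_ints.add_root[of "cnj x" m "cnj z"]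
    by (simp flip: complex_cnj_power)
next
  case (diff_root x z)
  then show ?case using cyclotomic_ints.diff_root[of "cnj x" m "cnj z"]
    by (simp flip: complex_cnj_power)
qed

lemma cyclotomic_ints_mono:
  assumes "k dvd m" shows "cyclotomic_ints k \<subseteq> cyclotomic_ints m"
proof
  have root: "z ^ m = 1" if "z ^ k = 1" for z :: complex
    using assms that by (auto simp: power_mult)
  fix x assume "x \<in> cyclotomic_ints k"
  then show "x \<in> cyclotomic_ints m"
    by induction (auto intro: cyclotomic_ints.intros root)
qed

lemmas cyclotomic_ints_intros =
  cyclotomic_ints.zero cyclotomic_ints_1 cyclotomic_ints_add cyclotomic_ints_uminus
  cyclotomic_ints_diff cyclotomic_ints_mult cyclotomic_ints_power cyclotomic_ints_sum
  cyclotomic_ints_of_nat cyclotomic_ints_of_int cyclotomic_ints_cnj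

section \<open>Spanning by powers of one root, and integrality over the integers\<close>

lemma roots_of_unity_powers:
  assumes "m > 0" "z ^ m = 1"
  obtains k where "k < m" "z = cis (2 * pi / real m) ^ k"
proof -
  have "z \<in> (\<lambda>k. cis (2 * pi * real k / real m)) ` {..<m}"
    using bij_betw_roots_unity[OF assms(1)] assms(2) by (auto simp: bij_betw_def)
  then obtain k where k: "k < m" "z = cis (2 * pi * real k / real m)" by auto
  moreover have "cis (2 * pi * real k / real m) = cis (2 * pi / real m) ^ k"
    by (simp add: Complex.DeMoivre mult_ac)
  ultimately show thesis using that by simp
qed

lemma cis_power_order: "m > 0 \<Longrightarrow> cis (2 * pi / real m) ^ m = 1"
  by (simp add: Complex.DeMoivre)

lemma root_of_unity_mult_cnj:
  assumes "z ^ k = 1" "k > 0"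
  shows "z * cnj z = (1 :: complex)"
proof -
  have "norm z ^ k = 1 ^ k" using assms(1) by (simp flip: norm_power)
  then have "norm z = 1" using power_eq_imp_eq_base[of "norm z" k 1] assms(2) by simp
  then show ?thesis by (simp flip: complex_norm_square)
qed

lemma cyclotomic_ints_coeffs:
  assumes "m > 0" "x \<in> cyclotomic_ints m"
  shows "\<exists>c :: nat \<Rightarrow> int. x = (\<Sum>k<m. of_int (c k) * cis (2 * pi / real m) ^ k)"
  using assms(2)
proof induction
  case zero
  show ?case by (rule exI[of _ "\<lambda>_. 0"]) simp
next
  case (add_root x z)
  then obtain c where c: "x = (\<Sum>k<m. of_int (c k) * cis (2 * pi / real m) ^ k)" by blast
  obtain l where l: "l < m" "z = cis (2 * pi / real m) ^ l"
    using roots_of_unity_powers[OF assms(1) add_root.hyps(2)] .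
  have "(\<Sum>k<m. of_int ((c(l := c l + 1)) k) * cis (2 * pi / real m) ^ k)
      = (\<Sum>k<m. of_int (c k) * cis (2 * pi / real m) ^ k + (if k = l then z else 0))"
    using l by (intro sum.cong) (auto simp: distrib_right)
  also have "\<dots> = x + z" using l(1) by (simp add: sum.distrib c)
  finally show ?case by (intro exI) (rule sym)
next
  case (diff_root x z)
  then obtain c where c: "x = (\<Sum>k<m. of_int (c k) * cis (2 * pi / real m) ^ k)" by blast
  obtain l where l: "l < m" "z = cis (2 * pi / real m) ^ l"
    using roots_of_unity_powers[OF assms(1) diff_root.hyps(2)] .
  have "(\<Sum>k<m. of_int ((c(l := c l - 1)) k) * cis (2 * pi / real m) ^ k)
      = (\<Sum>k<m. of_int (c k) * cis (2 * pi / real m) ^ k - (if k = l then z else 0))"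
    using l by (intro sum.cong) (auto simp: left_diff_distrib)
  also have "\<dots> = x - z" using l(1) by (simp add: sum_subtractf c)
  finally show ?case by (intro exI) (rule sym)
qed

text \<open>The determinant trick: \<open>u\<close> is an eigenvalue of an integer matrix, hence a
  root of its characteristic polynomial, which is monic with integer coefficients.\<close>

lemma algebraic_int_if_integer_eigenvector:
  fixes u :: complex and v :: "nat \<Rightarrow> complex" and C :: "nat \<Rightarrow> nat \<Rightarrow> int"
  assumes eig: "\<And>i. i < m \<Longrightarrow> u * v i = (\<Sum>j<m. of_int (C i j) * v j)"
    and "i0 < m" "v i0 \<noteq> 0"
  shows "algebraic_int u"
proof -
  define A where "A = mat m m (\<lambda>(i, j). C i j)"
  define B :: "complex mat" where "B = map_mat of_int A"
  have A: "A \<in> carrier_mat m m" and B: "B \<in> carrier_mat m m"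
    by (auto simp: A_def B_def)
  have "eigenvector B (vec m v) u"
    unfolding eigenvector_def
  proof (intro conjI)
    show "vec m v \<in> carrier_vec (dim_row B)" using B by simp
    show "vec m v \<noteq> 0\<^sub>v (dim_row B)"
      using assms(2,3) B by (metis carrier_matD(1) index_vec index_zero_vec(1))
    show "B *\<^sub>v vec m v = u \<cdot>\<^sub>v vec m v"
      by (rule eq_vecI) (auto simp: B_def A_def scalar_prod_def eig atLeast0LessThan)
  qed
  then have "poly (char_poly B) u = 0"
    using eigenvalue_root_char_poly[OF B] by (auto simp: eigenvalue_def)
  moreover have "char_poly B = map_poly of_int (char_poly A)"
    unfolding B_def by (rule of_int_hom.char_poly_hom[OF A])
  moreover have "lead_coeff (char_poly A) = 1"
    using degree_monic_char_poly[OF A] by simp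
  ultimately show ?thesis
    by (auto simp: algebraic_int_altdef_ipoly)
qed

text \<open>Multiplication by \<open>u\<close> sends each power of \<open>?w\<close> to an integer
  combination of the first \<open>m\<close> powers, so the vector of these powers is an eigenvector
  of an integer matrix; its entry at index 0 is 1.\<close>

lemma cyclotomic_ints_algebraic_int:
  assumes "m > 0" "u \<in> cyclotomic_ints m"
  shows "algebraic_int u"
proof -
  let ?w = "cis (2 * pi / real m)"
  have "u * ?w ^ i \<in> cyclotomic_ints m" for i
    by (rule cyclotomic_ints_mult[OF assms(2) cyclotomic_ints_power[OF
          cyclotomic_ints_root[OF cis_power_order[OF assms(1)]]]])
  then have "\<exists>c :: nat \<Rightarrow> int. u * ?w ^ i = (\<Sum>k<m. of_int (c k) * ?w ^ k)" for i
    using cyclotomic_ints_coeffs[OF assms(1)] by blast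
  then obtain C :: "nat \<Rightarrow> nat \<Rightarrow> int"
    where "\<And>i. u * ?w ^ i = (\<Sum>k<m. of_int (C i k) * ?w ^ k)" by metis
  then show ?thesis
    by (rule algebraic_int_if_integer_eigenvector[of m u "\<lambda>i. ?w ^ i" C 0]) (use assms in auto)
qed

section \<open>Divisibility of cyclotomic integers\<close>

text \<open>Only the cofactor is confined to the ring. Congruence of \<open>x\<close> and
  \<open>y\<close> modulo \<open>d\<close> is written \<open>cyc_dvd m d (x - y)\<close>.\<close>

definition cyc_dvd :: "nat \<Rightarrow> complex \<Rightarrow> complex \<Rightarrow> bool" where
  "cyc_dvd m d x \<longleftrightarrow> (\<exists>t\<in>cyclotomic_ints m. x = d * t)"

lemma cyc_dvdI: "t \<in> cyclotomic_ints m \<Longrightarrow> x = d * t \<Longrightarrow> cyc_dvd m d x"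
  by (auto simp: cyc_dvd_def)

lemma cyc_dvdE:
  assumes "cyc_dvd m d x"
  obtains t where "t \<in> cyclotomic_ints m" "x = d * t"
  using assms by (auto simp: cyc_dvd_def)

lemma cyc_dvd_refl: "cyc_dvd m d d"
  by (rule cyc_dvdI[OF cyclotomic_ints_1]) simp

lemma cyc_dvd_0: "cyc_dvd m d 0"
  by (rule cyc_dvdI[OF cyclotomic_ints.zero]) simp

lemma cyc_dvd_add: "cyc_dvd m d x \<Longrightarrow> cyc_dvd m d y \<Longrightarrow> cyc_dvd m d (x + y)"
  unfolding cyc_dvd_def by (metis cyclotomic_ints_add distrib_left)

lemma cyc_dvd_uminus: "cyc_dvd m d x \<Longrightarrow> cyc_dvd m d (- x)"
  unfolding cyc_dvd_def by (metis cyclotomic_ints_uminus mult_minus_right)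

lemma cyc_dvd_diff: "cyc_dvd m d x \<Longrightarrow> cyc_dvd m d y \<Longrightarrow> cyc_dvd m d (x - y)"
  using cyc_dvd_add[of m d x "- y"] cyc_dvd_uminus[of m d y] by simp

lemma cyc_dvd_diff_trans: "cyc_dvd m d (x - y) \<Longrightarrow> cyc_dvd m d (y - z) \<Longrightarrow> cyc_dvd m d (x - z)"
  using cyc_dvd_add[of m d "x - y" "y - z"] by simp

lemma cyc_dvd_sum: "(\<And>i. i \<in> I \<Longrightarrow> cyc_dvd m d (f i)) \<Longrightarrow> cyc_dvd m d (sum f I)"
  by (induction I rule: infinite_finite_induct) (auto intro: cyc_dvd_0 cyc_dvd_add)

lemma cyc_dvd_mult: "cyc_dvd m d x \<Longrightarrow> y \<in> cyclotomic_ints m \<Longrightarrow> cyc_dvd m d (x * y)"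
  unfolding cyc_dvd_def by (metis cyclotomic_ints_mult mult.assoc)

lemma cyc_dvd_mult_left: "cyc_dvd m d x \<Longrightarrow> y \<in> cyclotomic_ints m \<Longrightarrow> cyc_dvd m d (y * x)"
  using cyc_dvd_mult[of m d x y] by (simp add: mult.commute)

lemma cyc_dvd_trans: "cyc_dvd m d x \<Longrightarrow> cyc_dvd m c d \<Longrightarrow> cyc_dvd m c x"
  by (metis cyc_dvdE cyc_dvd_mult)

lemma cyc_dvd_mult_mono:
  assumes "cyc_dvd m c x" "cyc_dvd m d y"
  shows "cyc_dvd m (c * d) (x * y)"
proof -
  from assms obtain s t where "s \<in> cyclotomic_ints m" "x = c * s" "t \<in> cyclotomic_ints m" "y = d * t"
    by (auto simp: cyc_dvd_def)
  then show ?thesis by (intro cyc_dvdI[of "s * t"] cyclotomic_ints_mult) (simp_all add: mult_ac)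
qed

lemma cyc_dvd_power: "cyc_dvd m d x \<Longrightarrow> cyc_dvd m (d ^ k) (x ^ k)"
  by (induction k) (auto intro: cyc_dvd_refl cyc_dvd_mult_mono)

lemma cyc_dvd_prod:
  "(\<And>i. i \<in> I \<Longrightarrow> cyc_dvd m d (f i)) \<Longrightarrow> cyc_dvd m (d ^ card I) (prod f I)"
  by (induction I rule: infinite_finite_induct) (auto intro: cyc_dvd_refl cyc_dvd_mult_mono)

lemma cyc_dvd_power_le:
  assumes "d \<in> cyclotomic_ints m" "i \<le> k"
  shows "cyc_dvd m (d ^ i) (d ^ k)"
  using assms by (intro cyc_dvdI[of "d ^ (k - i)"]) (auto intro: cyclotomic_ints_power simp flip: power_add)

lemma cyc_dvd_cancel: "c \<noteq> 0 \<Longrightarrow> cyc_dvd m (c * d) (c * x) \<longleftrightarrow> cyc_dvd m d x"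
  by (auto simp: cyc_dvd_def mult.assoc)

lemma cyc_dvd_power_diff:
  assumes "cyc_dvd m d (x - y)" "x \<in> cyclotomic_ints m" "y \<in> cyclotomic_ints m"
  shows "cyc_dvd m d (x ^ k - y ^ k)"
proof (cases k)
  case (Suc l)
  have "(\<Sum>i<Suc l. x ^ i * y ^ (l - i)) \<in> cyclotomic_ints m"
    using assms by (intro cyclotomic_ints_intros)
  then show ?thesis
    unfolding Suc diff_power_eq_sum using assms(1) by (intro cyc_dvd_mult)
qed (simp add: cyc_dvd_0)

text \<open>The cofactor would be \<open>1 / p\<close>, a rational algebraic integer and so an
  integer. This keeps congruences modulo \<open>p\<close> from being vacuous.\<close>

lemma not_cyc_dvd_prime_1:
  assumes "m > 0" "prime p"
  shows "\<not> cyc_dvd m (of_nat p) 1"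
proof
  assume "cyc_dvd m (of_nat p) 1"
  then obtain t where t: "t \<in> cyclotomic_ints m" "1 = of_nat p * t" by (rule cyc_dvdE)
  then have t_eq: "t = 1 / of_nat p" using assms(2) by (auto simp: field_simps)
  have "t \<in> \<int>"
    by (rule rational_algebraic_int_is_int[OF cyclotomic_ints_algebraic_int[OF assms(1) t(1)]])
       (simp add: t_eq)
  then obtain k :: int where "t = of_int k" by (auto elim: Ints_cases)
  then have "(of_int 1 :: complex) = of_int (int p * k)" using t(2) by simp
  then have "1 = int p * k" by (simp only: of_int_eq_iff)
  then have "int p dvd 1" by (metis dvd_triv_left)
  then show False using assms(2) by simp
qed

text \<open>Bezout coefficients write \<open>x\<close> as a combination of the two multiples. With
  \<open>p\<close> as one of the two numbers, this removes integer factors prime to \<open>p\<close>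
  modulo divisors of \<open>p\<close>.\<close>

lemma cyc_dvd_coprime:
  assumes "coprime k l" "cyc_dvd m d (of_nat k * x)" "cyc_dvd m d (of_nat l * x)"
  shows "cyc_dvd m d x"
proof -
  obtain a b where ab: "a * int k + b * int l = 1"
    using bezout_int[of "int k" "int l"] assms(1) by (auto simp: coprime_iff_gcd_eq_1)
  have "x = of_int (a * int k + b * int l) * x" by (simp add: ab)
  also have "\<dots> = of_int a * (of_nat k * x) + of_int b * (of_nat l * x)"
    by (simp add: algebra_simps)
  also have "cyc_dvd m d \<dots>"
    by (rule cyc_dvd_add[OF cyc_dvd_mult_left[OF assms(2) cyclotomic_ints_of_int]
          cyc_dvd_mult_left[OF assms(3) cyclotomic_ints_of_int]])
  finally show ?thesis .
qed

section \<open>The Frobenius congruence\<close>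

lemma cyc_dvd_freshman:
  assumes "prime p" "x \<in> cyclotomic_ints m" "y \<in> cyclotomic_ints m"
  shows "cyc_dvd m (of_nat p) ((x + y) ^ p - (x ^ p + y ^ p))"
proof -
  have p: "p > 0" using assms(1) prime_gt_0_nat by blast
  let ?f = "\<lambda>k. of_nat (p choose k) * x ^ k * y ^ (p - k)"
  have "(x + y) ^ p = (\<Sum>k\<le>p. ?f k)" by (rule binomial_ring)
  also have "{..p} = insert 0 (insert p {0<..<p})" using p by auto
  also have "(\<Sum>k\<in>\<dots>. ?f k) = y ^ p + x ^ p + (\<Sum>k\<in>{0<..<p}. ?f k)"
    using p by simp
  finally have "(x + y) ^ p - (x ^ p + y ^ p) = (\<Sum>k\<in>{0<..<p}. ?f k)" by simp
  also have "cyc_dvd m (of_nat p) \<dots>"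
  proof (intro cyc_dvd_sum cyc_dvd_mult)
    fix k assume "k \<in> {0<..<p}"
    then have "p dvd p choose k" by (intro dvd_choose_prime) (use assms(1) in auto)
    then obtain l where "p choose k = p * l" by (elim dvdE)
    then show "cyc_dvd m (of_nat p) (of_nat (p choose k))"
      by (intro cyc_dvdI[OF cyclotomic_ints_of_nat[of l]]) simp
  qed (use assms in \<open>auto intro: cyclotomic_ints_power\<close>)
  finally show ?thesis .
qed

lemma cyc_dvd_freshman_power:
  assumes "prime p" "x \<in> cyclotomic_ints m" "y \<in> cyclotomic_ints m"
  shows "cyc_dvd m (of_nat p) ((x + y) ^ (p ^ j) - (x ^ (p ^ j) + y ^ (p ^ j)))"
proof (induction j)
  case 0
  then show ?case by (simp add: cyc_dvd_0)
next
  case (Suc j)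
  have "cyc_dvd m (of_nat p) (((x + y) ^ (p ^ j)) ^ p - (x ^ (p ^ j) + y ^ (p ^ j)) ^ p)"
    using assms by (intro cyc_dvd_power_diff Suc cyclotomic_ints_intros)
  moreover have "cyc_dvd m (of_nat p)
      ((x ^ (p ^ j) + y ^ (p ^ j)) ^ p - ((x ^ (p ^ j)) ^ p + (y ^ (p ^ j)) ^ p))"
    using assms by (intro cyc_dvd_freshman cyclotomic_ints_intros)
  ultimately show ?case
    unfolding power_Suc2 power_mult by (rule cyc_dvd_diff_trans)
qed

text \<open>Raising to the power \<open>p ^ j\<close> and conjugation are both additive modulo
  \<open>d\<close>, so agreement on single roots spreads to all sums. The cases used are
  \<open>k = h\<close> modulo \<open>p\<close> and \<open>k = m\<close> modulo
  \<open>1 - \<zeta>\<close>.\<close>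

lemma frobenius_cnj:
  assumes "prime p" "cyc_dvd m d (of_nat p)" "k dvd m"
    and roots: "\<And>z. z ^ k = 1 \<Longrightarrow> cyc_dvd m d (z ^ (p ^ j) - cnj z)"
    and "x \<in> cyclotomic_ints k"
  shows "cyc_dvd m d (x ^ (p ^ j) - cnj x)"
  using assms(5)
proof induction
  case zero
  have "p ^ j > 0" using assms(1) by (simp add: prime_gt_0_nat)
  then show ?case by (simp add: cyc_dvd_0 zero_power)
next
  case (add_root x z)
  have "x \<in> cyclotomic_ints m" "z \<in> cyclotomic_ints m"
    using add_root cyclotomic_ints_mono[OF assms(3)] cyclotomic_ints_root by blast+
  then have "cyc_dvd m d ((x + z) ^ (p ^ j) - (x ^ (p ^ j) + z ^ (p ^ j)))"
    using cyc_dvd_freshman_power[OF assms(1)] assms(2) cyc_dvd_trans by blast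
  from cyc_dvd_add[OF cyc_dvd_add[OF this add_root.IH] roots[OF add_root.hyps(2)]]
  show ?case by (simp add: algebra_simps)
next
  case (diff_root x z)
  have "x \<in> cyclotomic_ints m" and z: "z \<in> cyclotomic_ints m"
    using diff_root cyclotomic_ints_mono[OF assms(3)] cyclotomic_ints_root by blast+
  then have "x - z \<in> cyclotomic_ints m" by (rule cyclotomic_ints_diff)
  \<comment> \<open>Additivity is applied to \<open>x = (x - z) + z\<close>, which avoids the sign
    of \<open>(- 1) ^ (p ^ j)\<close> when \<open>p = 2\<close>.\<close>
  then have "cyc_dvd m d (((x - z) + z) ^ (p ^ j) - ((x - z) ^ (p ^ j) + z ^ (p ^ j)))"
    using z cyc_dvd_freshman_power[OF assms(1)] assms(2) cyc_dvd_trans by blast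
  from cyc_dvd_diff[OF cyc_dvd_diff[OF diff_root.IH this] roots[OF diff_root.hyps(2)]]
  show ?case by (simp add: algebra_simps)
qed

lemma frobenius_twice:
  assumes "k dvd m"
    and frob: "\<And>x. x \<in> cyclotomic_ints k \<Longrightarrow> cyc_dvd m d (x ^ P - cnj x)"
    and x: "x \<in> cyclotomic_ints k"
  shows "cyc_dvd m d (x ^ (P * P) - x)"
proof -
  have xm: "x \<in> cyclotomic_ints m" using x cyclotomic_ints_mono[OF assms(1)] by blast
  have "cyc_dvd m d ((x ^ P) ^ P - cnj x ^ P)"
    using xm by (intro cyc_dvd_power_diff frob x cyclotomic_ints_intros)
  moreover have "cyc_dvd m d (cnj x ^ P - x)"
    using frob[OF cyclotomic_ints_cnj[OF x]] by simp
  ultimately show ?thesis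
    unfolding power_mult by (rule cyc_dvd_diff_trans)
qed

text \<open>Modulo \<open>d\<close>, \<open>x ^ Suc P\<close> is congruent to
  \<open>x * cnj x\<close> and so to 0, while \<open>x\<close> is congruent to
  \<open>x ^ (P * P)\<close>, a multiple of \<open>x ^ Suc P\<close>. Thus \<open>d\<close> behaves
  as a radical modulus without being prime.\<close>

lemma cyc_dvd_if_cyc_dvd_norm:
  assumes "k dvd m" "P \<ge> 2"
    and frob: "\<And>x. x \<in> cyclotomic_ints k \<Longrightarrow> cyc_dvd m d (x ^ P - cnj x)"
    and x: "x \<in> cyclotomic_ints k" and norm: "cyc_dvd m d (x * cnj x)"
  shows "cyc_dvd m d x"
proof -
  have xm: "x \<in> cyclotomic_ints m" using x cyclotomic_ints_mono[OF assms(1)] by blast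
  have "cyc_dvd m d (x * (x ^ P - cnj x) + x * cnj x)"
    by (rule cyc_dvd_add[OF cyc_dvd_mult_left[OF frob[OF x] xm] norm])
  then have "cyc_dvd m d (x ^ Suc P)" by (simp add: algebra_simps)
  moreover have "Suc P \<le> P * P" using assms(2) mult_le_mono1[of 2 P P] by linarith
  ultimately have "cyc_dvd m d (x ^ (P * P))"
    using cyc_dvd_power_le[OF xm] cyc_dvd_trans by blast
  from cyc_dvd_diff[OF this frobenius_twice[OF assms(1) frob x]] show ?thesis by simp
qed

text \<open>Once \<open>s = \<pi> ^ k * t\<close>, cancelling \<open>\<pi> ^ (2 * k)\<close> from
  the norm leaves \<open>\<pi> ^ 2\<close> dividing \<open>t * cnj t\<close>, and
  \<open>base\<close> extracts one more factor from \<open>t\<close>.\<close>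

lemma cyc_dvd_norm_descent:
  assumes \<pi>: "\<pi> \<in> cyclotomic_ints m" "\<pi> \<noteq> 0" and cnj_\<pi>: "cyc_dvd m (cnj \<pi>) \<pi>"
    and base: "\<And>x. x \<in> cyclotomic_ints m \<Longrightarrow> cyc_dvd m \<pi> (x * cnj x) \<Longrightarrow> cyc_dvd m \<pi> x"
    and s: "s \<in> cyclotomic_ints m" and norm: "cyc_dvd m (\<pi> ^ (2 * k)) (s * cnj s)"
  shows "cyc_dvd m (\<pi> ^ k) s"
  using norm
proof (induction k)
  case 0
  show ?case using s by (intro cyc_dvdI[of s]) auto
next
  case (Suc k)
  have "cyc_dvd m (\<pi> ^ (2 * k)) (\<pi> ^ (2 * Suc k))"
    by (rule cyc_dvd_power_le[OF \<pi>(1)]) simp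
  with Suc obtain t where t: "t \<in> cyclotomic_ints m" "s = \<pi> ^ k * t"
    using cyc_dvd_trans by (metis cyc_dvdE)
  obtain u where u: "u \<in> cyclotomic_ints m" "\<pi> = cnj \<pi> * u" using cnj_\<pi> by (rule cyc_dvdE)
  \<comment> \<open>The factor \<open>u ^ k\<close> converts the \<open>cnj \<pi> ^ k\<close> inside
    \<open>cnj s\<close> into \<open>\<pi> ^ k\<close>.\<close>
  have "cyc_dvd m (\<pi> ^ (2 * Suc k)) (s * cnj s * u ^ k)"
    using Suc.prems cyclotomic_ints_power[OF u(1)] by (rule cyc_dvd_mult)
  also have "s * cnj s * u ^ k = \<pi> ^ k * (cnj \<pi> * u) ^ k * (t * cnj t)"
    by (simp add: t(2) power_mult_distrib mult_ac)
  also have "\<dots> = \<pi> ^ (2 * k) * (t * cnj t)"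
    using u(2) by (simp add: mult_2 power_add)
  also have "\<pi> ^ (2 * Suc k) = \<pi> ^ (2 * k) * (\<pi> ^ 2)" by (simp add: power2_eq_square)
  finally have "cyc_dvd m (\<pi> ^ 2) (t * cnj t)" using \<pi>(2) by (simp add: cyc_dvd_cancel)
  moreover have "cyc_dvd m \<pi> (\<pi> ^ 2)" using cyc_dvd_power_le[OF \<pi>(1), of 1 2] by simp
  ultimately have "cyc_dvd m \<pi> t" using base[OF t(1)] cyc_dvd_trans by blast
  then have "cyc_dvd m (\<pi> ^ k * \<pi>) (\<pi> ^ k * t)" using \<pi>(2) by (simp add: cyc_dvd_cancel)
  then show ?case by (simp add: t(2) mult.commute)
qed

section \<open>Products over roots of unity and polynomial values\<close>

text \<open>Both sides have degree at most \<open>N\<close>, the same coefficient at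
  \<open>N\<close>, and the same values at the \<open>N\<close> roots of unity.\<close>

lemma prod_linear_roots_of_unity:
  assumes "N > 0"
  shows "(\<Prod>i<N. [:- (cis (2 * pi / real N) ^ i), 1:]) = [:0, 1:] ^ N - 1"
proof (rule poly_eqI_degree_lead_coeff[where n = N and A = "{z. z ^ N = 1}"])
  let ?L = "\<Prod>i<N. [:- (cis (2 * pi / real N) ^ i), 1:]"
  have degL: "degree ?L = N" by (subst degree_prod_sum_eq) auto
  have "lead_coeff ?L = 1" by (simp add: lead_coeff_prod)
  then have "poly.coeff ?L N = 1" by (simp add: degL)
  moreover have X: "[:0, 1 :: complex:] ^ N = Polynomial.monom 1 N"
    by (simp add: monom_altdef)
  ultimately show "poly.coeff ?L N = poly.coeff ([:0, 1:] ^ N - 1) N"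
    using assms by simp
  show "degree ?L \<le> N" using degL by simp
  show "degree ([:0, 1 :: complex:] ^ N - 1) \<le> N"
    by (intro degree_diff_le) (auto simp: X degree_monom_eq)
  show "N \<le> card {z :: complex. z ^ N = 1}" using card_roots_unity_eq[OF assms] by simp
  fix z :: complex assume "z \<in> {z. z ^ N = 1}"
  then obtain k where "k < N" "z = cis (2 * pi / real N) ^ k"
    using roots_of_unity_powers[OF assms, of z] by blast
  then have "poly ?L z = 0" by (auto simp: poly_prod)
  then show "poly ?L z = poly ([:0, 1:] ^ N - 1) z"
    using \<open>z \<in> {z. z ^ N = 1}\<close> by simp
qed

text \<open>Evaluate the factorization at \<open>inverse y\<close> and multiply each of the
  \<open>N\<close> factors by \<open>y\<close>.\<close>

lemma prod_one_minus_roots_of_unity_mult: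
  assumes "N > 0" "y \<noteq> 0"
  shows "(\<Prod>i<N. 1 - cis (2 * pi / real N) ^ i * y) = 1 - y ^ N"
proof -
  have "(\<Prod>i<N. inverse y - cis (2 * pi / real N) ^ i) = inverse y ^ N - 1"
    using arg_cong[OF prod_linear_roots_of_unity[OF assms(1)], of "\<lambda>q. poly q (inverse y)"]
    by (simp add: poly_prod)
  then have "(\<Prod>i<N. y * (inverse y - cis (2 * pi / real N) ^ i)) = y ^ N * (inverse y ^ N - 1)"
    by (simp add: prod.distrib)
  then show ?thesis using assms(2) by (simp add: right_diff_distrib mult.commute power_inverse)
qed

text \<open>The factor for \<open>i = 0\<close> vanishes at 1, so it is cancelled between
  polynomials before evaluating there.\<close>

lemma prod_one_minus_roots_of_unity:
  assumes "N > 0"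
  shows "(\<Prod>i\<in>{0<..<N}. 1 - cis (2 * pi / real N) ^ i) = of_nat N"
proof -
  let ?l = "\<lambda>i. [:- (cis (2 * pi / real N) ^ i), 1:]"
  have "{..<N} = insert 0 {0<..<N}" using assms by auto
  then have "(\<Prod>i<N. ?l i) = [:-1, 1:] * (\<Prod>i\<in>{0<..<N}. ?l i)" by simp
  moreover have "[:0, 1 :: complex:] ^ N - 1 = [:-1, 1:] * (\<Sum>i<N. [:0, 1:] ^ i)"
    by (subst power_diff_1_eq) (simp add: one_pCons)
  ultimately have "[:-1, 1:] * (\<Prod>i\<in>{0<..<N}. ?l i) = [:-1, 1:] * (\<Sum>i<N. [:0, 1:] ^ i)"
    using prod_linear_roots_of_unity[OF assms] by simp
  then have "(\<Prod>i\<in>{0<..<N}. ?l i) = (\<Sum>i<N. [:0, 1:] ^ i)"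
    by (subst (asm) mult_cancel_left) simp
  from arg_cong[OF this, of "\<lambda>q. poly q 1"] show ?thesis
    by (simp add: poly_prod poly_sum)
qed

text \<open>Division by \<open>X - 1\<close> is Horner's scheme: the coefficients of the quotient
  are values at 1 of tails of \<open>g\<close>, so they stay in the ring.\<close>

lemma cyclotomic_ints_synthetic_div_coeff:
  assumes "\<And>i. poly.coeff g i \<in> cyclotomic_ints m"
  shows "poly g 1 \<in> cyclotomic_ints m" "poly.coeff (synthetic_div g 1) i \<in> cyclotomic_ints m"
proof -
  have *: "poly g 1 \<in> cyclotomic_ints m" if "\<And>i. poly.coeff g i \<in> cyclotomic_ints m" for g
    using that by (auto simp: poly_altdef intro: cyclotomic_ints_sum)
  show "poly g 1 \<in> cyclotomic_ints m" using assms by (rule *)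
  show "poly.coeff (synthetic_div g 1) i \<in> cyclotomic_ints m"
    using assms
  proof (induction g arbitrary: i)
    case 0
    then show ?case by (simp add: cyclotomic_ints.zero)
  next
    case (pCons b g)
    have g: "poly.coeff g i \<in> cyclotomic_ints m" for i
      using pCons.prems[of "Suc i"] by simp
    show ?case by (cases i) (simp_all add: *[OF g] pCons.IH[OF g])
  qed
qed

text \<open>Independence of the powers of \<open>\<zeta>\<close>, by expanding \<open>g\<close>
  around 1. Write \<open>g = (X - 1) * g1 + g(1)\<close>. Modulo \<open>1 - \<zeta>\<close> the
  value \<open>g(1)\<close> vanishes; \<open>red\<close>, which expresses that \<open>h\<close>-th
  roots generate an unramified ring, raises this to the full power. Subtracting it and cancelling
  one factor leaves the same problem for \<open>g1\<close>.\<close>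

lemma cyc_dvd_coeffs_if_cyc_dvd_poly:
  assumes "h dvd m" and \<zeta>: "\<zeta> ^ m = 1" "\<zeta> \<noteq> 1"
    and red: "\<And>r. r \<in> cyclotomic_ints h \<Longrightarrow> cyc_dvd m (1 - \<zeta>) r \<Longrightarrow> cyc_dvd m ((1 - \<zeta>) ^ e) r"
    and "k \<le> e" and "\<And>i. poly.coeff g i \<in> cyclotomic_ints h" and "\<And>i. i \<ge> k \<Longrightarrow> poly.coeff g i = 0"
    and "cyc_dvd m ((1 - \<zeta>) ^ k) (poly g \<zeta>)"
  shows "cyc_dvd m (1 - \<zeta>) (poly.coeff g i)"
  using assms(5-8)
proof (induction k arbitrary: g i)
  case 0
  then show ?case by (simp add: cyc_dvd_0)
next
  case (Suc k)
  let ?\<pi> = "1 - \<zeta>"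
  define g1 where "g1 = synthetic_div g 1"
  have \<zeta>S: "\<zeta> \<in> cyclotomic_ints m" using \<zeta>(1) by (rule cyclotomic_ints_root)
  have \<pi>S: "?\<pi> \<in> cyclotomic_ints m" using \<zeta>S by (intro cyclotomic_ints_diff cyclotomic_ints_1)
  have g: "g = [:-1, 1:] * g1 + [:poly g 1:]"
    using synthetic_div_correct'[of 1 g] by (simp add: g1_def)
  have g1h: "poly.coeff g1 i \<in> cyclotomic_ints h" for i
    unfolding g1_def by (rule cyclotomic_ints_synthetic_div_coeff(2)[OF Suc.prems(2)])
  then have g1m: "poly.coeff g1 i \<in> cyclotomic_ints m" for i
    using cyclotomic_ints_mono[OF assms(1)] by blast
  have g1\<zeta>: "poly g1 \<zeta> \<in> cyclotomic_ints m"
    unfolding poly_altdef by (intro cyclotomic_ints_sum cyclotomic_ints_mult cyclotomic_ints_power g1m \<zeta>S)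
  \<comment> \<open>Division lowers the degree by one, except that a constant has quotient 0, whose
    degree is not below 0.\<close>
  have g1_0: "poly.coeff g1 i = 0" if "i \<ge> k" for i
  proof (cases "degree g = 0")
    case True
    then show ?thesis by (simp add: g1_def synthetic_div_eq_0_iff[THEN iffD2])
  next
    case False
    have "degree g \<le> k" by (rule degree_le) (use Suc.prems(3) in auto)
    then have "degree g1 < i" using that False by (simp add: g1_def degree_synthetic_div)
    then show ?thesis by (rule coeff_eq_0)
  qed
  have "poly g \<zeta> = (\<zeta> - 1) * poly g1 \<zeta> + poly g 1"
    by (subst g) (simp add: algebra_simps)
  then have g_\<zeta>: "poly g \<zeta> = - (?\<pi> * poly g1 \<zeta>) + poly g 1" by (simp add: algebra_simps)
  have "cyc_dvd m (?\<pi> ^ 1) (?\<pi> ^ Suc k)" by (rule cyc_dvd_power_le[OF \<pi>S]) simp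
  then have "cyc_dvd m ?\<pi> (poly g \<zeta>)"
    using cyc_dvd_trans[OF Suc.prems(4)] by simp
  from cyc_dvd_add[OF this cyc_dvd_mult[OF cyc_dvd_refl g1\<zeta>]]
  have g_1: "cyc_dvd m ?\<pi> (poly g 1)" by (simp add: g_\<zeta>)
  then have "cyc_dvd m (?\<pi> ^ e) (poly g 1)"
    by (intro red cyclotomic_ints_synthetic_div_coeff(1) Suc.prems(2))
  then have "cyc_dvd m (?\<pi> ^ Suc k) (poly g 1)"
    using cyc_dvd_power_le[OF \<pi>S Suc.prems(1)] cyc_dvd_trans by blast
  from cyc_dvd_diff[OF this Suc.prems(4)]
  have "cyc_dvd m (?\<pi> * ?\<pi> ^ k) (?\<pi> * poly g1 \<zeta>)" by (simp add: g_\<zeta>)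
  then have "cyc_dvd m (?\<pi> ^ k) (poly g1 \<zeta>)" using \<zeta>(2) by (simp add: cyc_dvd_cancel)
  then have IH: "cyc_dvd m ?\<pi> (poly.coeff g1 i)" for i
    using Suc.prems(1) by (intro Suc.IH g1h g1_0) auto
  have "poly.coeff g i = - poly.coeff g1 i + poly.coeff (pCons (poly g 1) g1) i"
    by (subst g) (simp add: coeff_pCons split: nat.split)
  also have "cyc_dvd m ?\<pi> \<dots>"
    by (intro cyc_dvd_add cyc_dvd_uminus IH) (use IH g_1 in \<open>auto simp: coeff_pCons split: nat.split\<close>)
  finally show ?case .
qed

section \<open>A self-conjugate prime and its ramification\<close>

text \<open>\<open>N\<close> is the part of the modulus prime to \<open>p\<close>, and
  \<open>h_dvd\<close> records that \<open>p\<close> does not divide \<open>h\<close>. Taking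
  \<open>j > 0\<close> makes the Frobenius exponent \<open>p ^ j\<close> at least 2.\<close>

locale self_conjugate_prime =
  fixes p a N j h :: nat
  assumes prime: "prime p" and a_pos: "a > 0" and N_pos: "N > 0" and coprime_N: "coprime p N"
    and j_pos: "j > 0" and N_dvd: "N dvd p ^ j + 1" and h_dvd: "h dvd N"
begin

abbreviation "m \<equiv> p ^ a * N"
abbreviation "q \<equiv> p ^ (a - 1)"
abbreviation "e \<equiv> (p - 1) * q"
definition "\<zeta> = cis (2 * pi / real (p ^ a))"
abbreviation "\<pi> \<equiv> 1 - \<zeta>"

lemma p_gt_1: "p > 1"
  using prime by (rule prime_gt_1_nat)

lemma p_pow_a: "p ^ a = p * q"
  using a_pos by (simp flip: power_Suc)

lemma m_pos: "m > 0"
  using p_gt_1 N_pos by simp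

lemma h_dvd_m: "h dvd m"
  using h_dvd by simp

lemma coprime_h: "coprime p h"
  using coprime_N h_dvd by (metis coprime_divisors dvd_refl)

lemma pow_j_ge_2: "p ^ j \<ge> 2"
  using p_gt_1 j_pos power_increasing[of 1 j p] by simp

lemma zeta_power_pa: "\<zeta> ^ (p ^ a) = 1"
  unfolding \<zeta>_def by (rule cis_power_order) (use p_gt_1 in simp)

lemma zeta_power_m: "\<zeta> ^ m = 1"
  by (simp add: power_mult zeta_power_pa)

lemma zeta_int: "\<zeta> \<in> cyclotomic_ints m"
  by (rule cyclotomic_ints_root) (rule zeta_power_m)

lemma pi_int: "\<pi> \<in> cyclotomic_ints m"
  by (intro cyclotomic_ints_diff cyclotomic_ints_1 zeta_int)

lemma zeta_power_q: "\<zeta> ^ q = cis (2 * pi / real p)"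
  using p_gt_1 by (simp add: \<zeta>_def Complex.DeMoivre p_pow_a)

lemma zeta_power_p: "\<zeta> ^ p = cis (2 * pi / real q)"
  using p_gt_1 by (simp add: \<zeta>_def Complex.DeMoivre p_pow_a)

lemma zeta_q_neq_1: "\<zeta> ^ q \<noteq> 1"
proof
  assume "\<zeta> ^ q = 1"
  then have "cis (2 * pi * real 1 / real p) = cis (2 * pi * real 0 / real p)"
    unfolding zeta_power_q by simp
  moreover have "inj_on (\<lambda>k. cis (2 * pi * real k / real p)) {..<p}"
    using bij_betw_roots_unity[of p] p_gt_1 by (simp add: bij_betw_def)
  ultimately have "(1 :: nat) = 0" using p_gt_1 by (elim inj_onD) auto
  then show False by simp
qed

lemma zeta_neq_1: "\<zeta> \<noteq> 1"
  using zeta_q_neq_1 by auto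

lemma cyc_dvd_one_minus_zeta_power: "cyc_dvd m \<pi> (1 - \<zeta> ^ l)"
  using cyc_dvd_power_diff[OF cyc_dvd_refl cyclotomic_ints_1 zeta_int, of l] by simp

lemma cyc_dvd_cnj_pi: "cyc_dvd m (cnj \<pi>) \<pi>"
proof (rule cyc_dvdI)
  show "- \<zeta> \<in> cyclotomic_ints m" by (intro cyclotomic_ints_uminus zeta_int)
  have "\<zeta> * cnj \<zeta> = 1" by (simp add: \<zeta>_def cis_cnj cis_mult)
  then show "\<pi> = cnj \<pi> * - \<zeta>" by (simp add: algebra_simps)
qed

text \<open>With \<open>?\<omega> = \<zeta> ^ q\<close>, \<open>p\<close> is the product of the
  \<open>p - 1\<close> numbers \<open>1 - ?\<omega> ^ i\<close>, each a multiple of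
  \<open>1 - ?\<omega>\<close>. In turn \<open>1 - ?\<omega>\<close> is the product of the
  \<open>q\<close> numbers \<open>1 - \<zeta> ^ (p * i + 1)\<close>, each a multiple of
  \<open>\<pi>\<close>.\<close>

lemma cyc_dvd_pi_power_prime: "cyc_dvd m (\<pi> ^ e) (of_nat p)"
proof -
  let ?\<omega> = "\<zeta> ^ q"
  have q_pos: "q > 0" using p_gt_1 by simp
  have \<omega>: "?\<omega> \<in> cyclotomic_ints m" by (intro cyclotomic_ints_power zeta_int)
  have "cyc_dvd m ((1 - ?\<omega>) ^ card {0<..<p}) (\<Prod>i\<in>{0<..<p}. 1 - ?\<omega> ^ i)"
  proof (rule cyc_dvd_prod)
    show "cyc_dvd m (1 - ?\<omega>) (1 - ?\<omega> ^ i)" for i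
      using cyc_dvd_power_diff[OF cyc_dvd_refl cyclotomic_ints_1 \<omega>, of i] by simp
  qed
  also have "(\<Prod>i\<in>{0<..<p}. 1 - ?\<omega> ^ i) = of_nat p"
    unfolding zeta_power_q by (rule prod_one_minus_roots_of_unity) (use p_gt_1 in simp)
  finally have 1: "cyc_dvd m ((1 - ?\<omega>) ^ (p - 1)) (of_nat p)" by simp
  have "cyc_dvd m (\<pi> ^ card {..<q}) (\<Prod>i<q. 1 - (\<zeta> ^ p) ^ i * \<zeta>)"
  proof (rule cyc_dvd_prod)
    show "cyc_dvd m \<pi> (1 - (\<zeta> ^ p) ^ i * \<zeta>)" for i
      using cyc_dvd_one_minus_zeta_power[of "p * i + 1"] by (simp only: power_add power_mult power_one_right)
  qed
  also have "(\<Prod>i<q. 1 - (\<zeta> ^ p) ^ i * \<zeta>) = 1 - ?\<omega>"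
    unfolding zeta_power_p
    by (rule prod_one_minus_roots_of_unity_mult[OF q_pos]) (simp add: \<zeta>_def)
  finally have "cyc_dvd m (\<pi> ^ q) (1 - ?\<omega>)" by simp
  then have "cyc_dvd m ((\<pi> ^ q) ^ (p - 1)) ((1 - ?\<omega>) ^ (p - 1))" by (rule cyc_dvd_power)
  from cyc_dvd_trans[OF 1 this] show ?thesis
    unfolding power_mult[symmetric] by (simp only: mult.commute)
qed

lemma e_pos: "e > 0"
  using p_gt_1 by simp

lemma cyc_dvd_pi_prime: "cyc_dvd m \<pi> (of_nat p)"
proof -
  have "cyc_dvd m (\<pi> ^ 1) (\<pi> ^ e)" by (rule cyc_dvd_power_le[OF pi_int]) (use e_pos in linarith)
  then show ?thesis using cyc_dvd_trans[OF cyc_dvd_pi_power_prime] by simp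
qed

text \<open>Since \<open>\<pi> + \<zeta> = 1\<close> and \<open>\<zeta> ^ (p ^ a) = 1\<close>,
  additivity of the \<open>p ^ a\<close>-th power modulo \<open>p\<close> shows that
  \<open>p\<close> divides \<open>\<pi> ^ (p ^ a)\<close>. If \<open>\<pi>\<close> were a unit,
  \<open>p\<close> would be one too.\<close>

lemma not_cyc_dvd_pi_1: "\<not> cyc_dvd m \<pi> 1"
proof
  assume "cyc_dvd m \<pi> 1"
  then have "cyc_dvd m (\<pi> ^ (p ^ a)) 1" using cyc_dvd_power[of m \<pi> 1 "p ^ a"] by simp
  moreover have "cyc_dvd m (of_nat p) (- (\<pi> ^ (p ^ a)))"
    using cyc_dvd_freshman_power[OF prime pi_int zeta_int, of a] by (simp add: zeta_power_pa)
  from cyc_dvd_uminus[OF this] have "cyc_dvd m (of_nat p) (\<pi> ^ (p ^ a))" by (simp only: minus_minus)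
  ultimately have "cyc_dvd m (of_nat p) 1" by (rule cyc_dvd_trans)
  then show False using not_cyc_dvd_prime_1[OF m_pos prime] by simp
qed

text \<open>As \<open>h\<close> divides \<open>p ^ j + 1\<close>, the power \<open>p ^ j\<close>
  inverts \<open>h\<close>-th roots exactly, and inversion of a root is conjugation.\<close>

lemma frobenius_cnj_prime:
  assumes "x \<in> cyclotomic_ints h"
  shows "cyc_dvd m (of_nat p) (x ^ (p ^ j) - cnj x)"
proof (rule frobenius_cnj[OF prime cyc_dvd_refl h_dvd_m _ assms])
  fix z :: complex assume z: "z ^ h = 1"
  have h_pos: "h > 0" using h_dvd N_pos by (metis dvd_pos_nat)
  have zz: "z * cnj z = 1" by (rule root_of_unity_mult_cnj[OF z h_pos])
  have "h dvd p ^ j + 1" using h_dvd N_dvd by (rule dvd_trans)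
  then obtain l where "p ^ j + 1 = h * l" by (elim dvdE)
  then have "z ^ (p ^ j + 1) = 1" by (simp only: power_mult z power_one)
  then have "z ^ (p ^ j) * (z * cnj z) = cnj z" by (simp add: mult_ac)
  then show "cyc_dvd m (of_nat p) (z ^ (p ^ j) - cnj z)" by (simp add: zz cyc_dvd_0)
qed

text \<open>For a general \<open>m\<close>-th root \<open>z\<close>, the power
  \<open>z ^ (p ^ j + 1)\<close> is only a \<open>p ^ a\<close>-th root of unity, thus a power of
  \<open>\<zeta>\<close> and congruent to 1 modulo \<open>\<pi>\<close>. The larger ring costs the
  weaker modulus.\<close>

lemma frobenius_cnj_pi:
  assumes "x \<in> cyclotomic_ints m"
  shows "cyc_dvd m \<pi> (x ^ (p ^ j) - cnj x)"
proof (rule frobenius_cnj[OF prime cyc_dvd_pi_prime dvd_refl _ assms])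
  fix z :: complex assume z: "z ^ m = 1"
  have zz: "z * cnj z = 1" by (rule root_of_unity_mult_cnj[OF z m_pos])
  obtain l where "p ^ j + 1 = N * l" using N_dvd by (elim dvdE)
  then have "(p ^ j + 1) * p ^ a = m * l" by (simp only: mult_ac)
  then have "(z ^ (p ^ j + 1)) ^ (p ^ a) = (z ^ m) ^ l" by (simp only: power_mult[symmetric])
  then have 1: "(z ^ (p ^ j + 1)) ^ (p ^ a) = 1" by (simp only: z power_one)
  have "p ^ a > 0" using p_gt_1 by simp
  from roots_of_unity_powers[OF this 1] obtain i where "z ^ (p ^ j + 1) = \<zeta> ^ i"
    unfolding \<zeta>_def by metis
  then have "z ^ (p ^ j) * (z * cnj z) = \<zeta> ^ i * cnj z" by (simp add: mult_ac)
  then have "z ^ (p ^ j) - cnj z = (1 - \<zeta> ^ i) * - cnj z" by (simp add: zz algebra_simps)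
  also have "cyc_dvd m \<pi> \<dots>"
    by (intro cyc_dvd_mult cyc_dvd_one_minus_zeta_power cyclotomic_ints_uminus
        cyclotomic_ints_cnj cyclotomic_ints_root z)
  finally show "cyc_dvd m \<pi> (z ^ (p ^ j) - cnj z)" .
qed

lemma cyc_dvd_prime_if_norm:
  assumes "x \<in> cyclotomic_ints h" "cyc_dvd m (of_nat p) (x * cnj x)"
  shows "cyc_dvd m (of_nat p) x"
  using h_dvd_m pow_j_ge_2 frobenius_cnj_prime assms by (rule cyc_dvd_if_cyc_dvd_norm)

text \<open>\<open>p ^ 2\<close> is a multiple of \<open>\<pi> ^ (2 * e)\<close>, and the descent
  halves the exponent.\<close>

lemma cyc_dvd_pi_power_if_norm:
  assumes "x \<in> cyclotomic_ints m" "cyc_dvd m (of_nat p ^ 2) (x * cnj x)"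
  shows "cyc_dvd m (\<pi> ^ e) x"
proof (rule cyc_dvd_norm_descent[OF pi_int _ cyc_dvd_cnj_pi _ assms(1)])
  show "\<pi> \<noteq> 0" using zeta_neq_1 by simp
  show "cyc_dvd m \<pi> y" if "y \<in> cyclotomic_ints m" "cyc_dvd m \<pi> (y * cnj y)" for y
    using dvd_refl pow_j_ge_2 frobenius_cnj_pi that by (rule cyc_dvd_if_cyc_dvd_norm)
  have "cyc_dvd m ((\<pi> ^ e) ^ 2) (of_nat p ^ 2)" by (rule cyc_dvd_power[OF cyc_dvd_pi_power_prime])
  then have "cyc_dvd m (\<pi> ^ (2 * e)) (of_nat p ^ 2)"
    by (simp only: power_mult[symmetric] mult.commute[of 2])
  then show "cyc_dvd m (\<pi> ^ (2 * e)) (x * cnj x)" by (rule cyc_dvd_trans[OF assms(2)])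
qed

text \<open>Iterating the Frobenius congruence, \<open>r\<close> is congruent modulo \<open>p\<close> to arbitrarily high
  powers of itself, so a single factor \<open>\<pi>\<close> is as good as \<open>\<pi> ^ e\<close>: \<open>p\<close> is unramified in the
  ring generated by the \<open>h\<close>-th roots of unity.\<close>
lemma cyc_dvd_pi_imp_cyc_dvd_pi_power:
  assumes r: "r \<in> cyclotomic_ints h" and "cyc_dvd m \<pi> r"
  shows "cyc_dvd m (\<pi> ^ e) r"
proof -
  let ?Q = "p ^ j * p ^ j"
  have rm: "r \<in> cyclotomic_ints m" using r cyclotomic_ints_mono[OF h_dvd_m] by blast
  have frob2: "cyc_dvd m (of_nat p) (r ^ ?Q - r)"
    using h_dvd_m frobenius_cnj_prime r by (rule frobenius_twice)
  have iter: "cyc_dvd m (of_nat p) (r ^ (?Q ^ k) - r)" for k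
  proof (induction k)
    case (Suc k)
    have "cyc_dvd m (of_nat p) ((r ^ (?Q ^ k)) ^ ?Q - r ^ ?Q)"
      using rm by (intro cyc_dvd_power_diff Suc cyclotomic_ints_power)
    from cyc_dvd_diff_trans[OF this frob2] show ?case
      by (simp only: power_Suc2 flip: power_mult)
  qed (simp add: cyc_dvd_0)
  have "e \<le> ?Q ^ e"
  proof -
    have "?Q \<ge> 2" using pow_j_ge_2 mult_le_mono[of 2 "p ^ j" 1 "p ^ j"] by linarith
    then have "2 ^ e \<le> ?Q ^ e" by (intro power_mono) auto
    then show ?thesis using less_exp[of e] by linarith
  qed
  then have "cyc_dvd m (\<pi> ^ e) (r ^ (?Q ^ e))"
    using cyc_dvd_power[OF assms(2)] cyc_dvd_power_le[OF pi_int] cyc_dvd_trans by blast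
  moreover have "cyc_dvd m (\<pi> ^ e) (r ^ (?Q ^ e) - r)"
    by (rule cyc_dvd_trans[OF iter cyc_dvd_pi_power_prime])
  ultimately have "cyc_dvd m (\<pi> ^ e) (r ^ (?Q ^ e) - (r ^ (?Q ^ e) - r))" by (rule cyc_dvd_diff)
  then show ?thesis by simp
qed

text \<open>If the quotient \<open>w\<close> of the two roots were not 1, its powers would sum to 0;
  each is congruent to 1 modulo \<open>\<pi>\<close>, so \<open>\<pi>\<close> would divide
  \<open>h\<close>. It also divides \<open>p\<close>, hence it would divide 1.\<close>

lemma roots_of_unity_eq_if_cyc_dvd_pi:
  assumes y: "y ^ h = 1" "y' ^ h = 1" and dvd: "cyc_dvd m \<pi> (y - y')"
  shows "y = y'"
proof (rule ccontr)
  assume neq: "y \<noteq> y'"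
  have h_pos: "h > 0" using h_dvd N_pos by (metis dvd_pos_nat)
  define w where "w = y' * cnj y"
  have yy: "y * cnj y = 1" by (rule root_of_unity_mult_cnj[OF y(1) h_pos])
  have cnj_y: "cnj y ^ h = 1" using y(1) by (metis complex_cnj_one complex_cnj_power)
  have w: "w ^ h = 1" by (simp add: w_def power_mult_distrib y(2) cnj_y)
  have wy: "w * y = y'" using yy by (simp add: w_def mult_ac)
  have "w \<noteq> 1" using neq wy by auto
  have root: "z \<in> cyclotomic_ints m" if "z ^ h = 1" for z
    using cyclotomic_ints_root[OF that] cyclotomic_ints_mono[OF h_dvd_m] by blast
  have "(y - y') * cnj y = 1 - w" by (simp add: left_diff_distrib yy w_def)
  then have 1: "cyc_dvd m \<pi> (1 - w)" using cyc_dvd_mult[OF dvd root[OF cnj_y]] by simp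
  have "(1 - w) * (\<Sum>i<h. w ^ i) = 0" using w by (simp add: one_diff_power_eq[symmetric])
  then have "(\<Sum>i<h. w ^ i) = 0" using \<open>w \<noteq> 1\<close> by simp
  then have "of_nat h * 1 = (\<Sum>i<h. 1 ^ i - w ^ i)" by (simp add: sum_subtractf)
  also have "cyc_dvd m \<pi> \<dots>"
    by (intro cyc_dvd_sum cyc_dvd_power_diff 1 cyclotomic_ints_1 root w)
  finally have "cyc_dvd m \<pi> (of_nat h * 1)" .
  then have "cyc_dvd m \<pi> 1"
    using cyc_dvd_coprime[OF coprime_h] cyc_dvd_pi_prime by simp
  then show False using not_cyc_dvd_pi_1 by simp
qed

text \<open>Subtract from \<open>y\<close> the \<open>q\<close>-periodic sequence that agrees with
  it on the last block \<open>e..<e + q\<close>. That sequence contributes 0 at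
  \<open>\<zeta>\<close>, because the powers of \<open>\<zeta> ^ q\<close> sum to 0. What remains is
  a polynomial of degree below \<open>e\<close>, to which independence applies; congruent roots of
  unity are then equal.\<close>

lemma coeffs_periodic:
  assumes y: "\<And>k. k < p ^ a \<Longrightarrow> y k ^ h = 1"
    and dvd: "cyc_dvd m (\<pi> ^ e) (\<Sum>k<p ^ a. y k * \<zeta> ^ k)" and k: "k < p ^ a"
  shows "y k = y (e + k mod q)"
proof -
  have q_pos: "q > 0" using p_gt_1 by simp
  have pa: "p ^ a = e + q" using p_gt_1 p_pow_a by (cases p) auto
  have bound: "e + k mod q < p ^ a" for k using q_pos by (simp add: pa)
  have high: "y k = y (e + k mod q)" if "e \<le> k" "k < p ^ a" for k
  proof -
    define i where "i = k - e"
    have i: "k = e + i" "i < q" using that by (auto simp: i_def pa)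
    then have "k mod q = i" by simp
    then show ?thesis by (simp only: i(1))
  qed
  have "(\<Sum>k<p * q. y (e + k mod q) * \<zeta> ^ k)
      = (\<Sum>u<p. \<Sum>k\<in>{u * q..<u * q + q}. y (e + k mod q) * \<zeta> ^ k)"
    by (rule sum.nat_group[symmetric])
  also have "\<dots> = (\<Sum>u<p. \<Sum>i<q. (\<zeta> ^ q) ^ u * (y (e + i) * \<zeta> ^ i))"
  proof (rule sum.cong[OF refl])
    fix u
    show "(\<Sum>k\<in>{u * q..<u * q + q}. y (e + k mod q) * \<zeta> ^ k)
        = (\<Sum>i<q. (\<zeta> ^ q) ^ u * (y (e + i) * \<zeta> ^ i))"
      by (rule sum.reindex_bij_witness[of _ "\<lambda>k. k - u * q" "\<lambda>i. u * q + i", symmetric])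
         (auto simp: power_add power_mult[symmetric] mult.commute[of u])
  qed
  also have "\<dots> = (\<Sum>u<p. (\<zeta> ^ q) ^ u) * (\<Sum>i<q. y (e + i) * \<zeta> ^ i)"
    by (simp add: sum_product)
  also have "(\<Sum>u<p. (\<zeta> ^ q) ^ u) = 0"
  proof -
    have "(\<zeta> ^ q) ^ p = 1" using zeta_power_pa by (simp only: p_pow_a mult.commute[of p] power_mult)
    then have "(1 - \<zeta> ^ q) * (\<Sum>u<p. (\<zeta> ^ q) ^ u) = 0" by (simp only: one_diff_power_eq[symmetric]) simp
    then show ?thesis using zeta_q_neq_1 by simp
  qed
  finally have zero: "(\<Sum>k<p ^ a. y (e + k mod q) * \<zeta> ^ k) = 0" by (simp only: p_pow_a mult_zero_left)
  \<comment> \<open>The value 0 from \<open>e\<close> on is the true difference, by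
    \<open>high\<close>, and gives the degree bound for \<open>g\<close>.\<close>
  define c where "c k = (if k < e then y k - y (e + k mod q) else 0)" for k
  define g where "g = (\<Sum>k<p ^ a. Polynomial.monom (c k) k)"
  have coeff_g: "poly.coeff g k = (if k < p ^ a then c k else 0)" for k
    by (simp add: g_def coeff_sum sum.delta)
  have root: "y k \<in> cyclotomic_ints h" if "k < p ^ a" for k
    by (rule cyclotomic_ints_root) (rule y[OF that])
  have "poly g \<zeta> = (\<Sum>k<p ^ a. c k * \<zeta> ^ k)"
    by (simp add: g_def poly_sum poly_monom)
  also have "\<dots> = (\<Sum>k<p ^ a. y k * \<zeta> ^ k - y (e + k mod q) * \<zeta> ^ k)"
  proof (rule sum.cong[OF refl])
    fix k assume "k \<in> {..<p ^ a}"
    then show "c k * \<zeta> ^ k = y k * \<zeta> ^ k - y (e + k mod q) * \<zeta> ^ k"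
      using high[of k] by (auto simp: c_def left_diff_distrib)
  qed
  also have "\<dots> = (\<Sum>k<p ^ a. y k * \<zeta> ^ k)" by (simp only: sum_subtractf zero diff_0_right)
  finally have dvd_g: "cyc_dvd m (\<pi> ^ e) (poly g \<zeta>)" using dvd by simp
  have "cyc_dvd m \<pi> (poly.coeff g k)"
  proof (rule cyc_dvd_coeffs_if_cyc_dvd_poly[OF h_dvd_m zeta_power_m zeta_neq_1
        cyc_dvd_pi_imp_cyc_dvd_pi_power order_refl _ _ dvd_g])
    show "poly.coeff g i \<in> cyclotomic_ints h" for i
      using root bound by (auto simp: coeff_g c_def intro!: cyclotomic_ints_diff cyclotomic_ints.zero)
    show "poly.coeff g i = 0" if "i \<ge> e" for i using that by (simp add: coeff_g c_def)
  qed
  then have "k < e \<Longrightarrow> cyc_dvd m \<pi> (y k - y (e + k mod q))" using k by (simp add: coeff_g c_def)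
  then show ?thesis
    using roots_of_unity_eq_if_cyc_dvd_pi[OF y[OF k] y[OF bound]] high[OF _ k] by (meson not_le)
qed

end

section \<open>Geometric sums, residue classes and cyclic shifts of finite sums\<close>

lemma sum_roots_of_unity_powers:
  assumes "N > 0"
  shows "(\<Sum>t<N. (cis (2 * pi / real N) ^ s) ^ t) = (if N dvd s then of_nat N else 0)"
proof (cases "N dvd s")
  case True
  then obtain l where "s = N * l" by (elim dvdE)
  then have "cis (2 * pi / real N) ^ s = 1" by (simp only: power_mult cis_power_order[OF assms] power_one)
  then show ?thesis using True by simp
next
  case False
  let ?w = "cis (2 * pi / real N) ^ s"
  have "?w \<noteq> 1"
  proof
    assume "?w = 1"
    moreover have "?w = cis (2 * pi / real N) ^ (N * (s div N) + s mod N)" by simp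
    then have "?w = cis (2 * pi / real N) ^ (s mod N)"
      by (simp only: power_add power_mult cis_power_order[OF assms] power_one mult_1)
    ultimately have "cis (2 * pi * real (s mod N) / real N) = cis (2 * pi * real 0 / real N)"
      by (simp add: Complex.DeMoivre mult_ac)
    moreover have "inj_on (\<lambda>k. cis (2 * pi * real k / real N)) {..<N}"
      using bij_betw_roots_unity[OF assms] by (simp add: bij_betw_def)
    ultimately have "s mod N = 0" using assms by (elim inj_onD) auto
    then show False using False by (simp add: dvd_eq_mod_eq_0)
  qed
  have "?w ^ N = 1"
    by (simp only: power_mult[symmetric] mult.commute[of s]) (simp only: power_mult cis_power_order[OF assms] power_one)
  then have "(1 - ?w) * (\<Sum>t<N. ?w ^ t) = 0" by (simp only: one_diff_power_eq[symmetric]) simp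
  then show ?thesis using \<open>?w \<noteq> 1\<close> False by simp
qed

lemma sum_residue_class:
  fixes \<phi> :: "nat \<Rightarrow> 'a :: comm_monoid_add"
  assumes "r < k"
  shows "(\<Sum>g<M * k. if g mod k = r then \<phi> g else 0) = (\<Sum>i<M. \<phi> (i * k + r))"
proof -
  have "(\<Sum>g<M * k. if g mod k = r then \<phi> g else 0)
      = (\<Sum>i<M. \<Sum>g\<in>{i * k..<i * k + k}. if g mod k = r then \<phi> g else 0)"
    by (rule sum.nat_group[symmetric])
  also have "\<dots> = (\<Sum>i<M. \<phi> (i * k + r))"
  proof (rule sum.cong[OF refl])
    fix i
    have "(g mod k = r) = (g = i * k + r)" if "g \<in> {i * k..<i * k + k}" for g
    proof -
      define l where "l = g - i * k"
      have l: "g = l + i * k" "l < k" using that by (auto simp: l_def)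
      then show ?thesis by auto
    qed
    then have "(\<Sum>g\<in>{i * k..<i * k + k}. if g mod k = r then \<phi> g else 0)
        = (\<Sum>g\<in>{i * k..<i * k + k}. if g = i * k + r then \<phi> g else 0)"
      by (intro sum.cong) auto
    also have "\<dots> = \<phi> (i * k + r)" using assms by simp
    finally show "(\<Sum>g\<in>{i * k..<i * k + k}. if g mod k = r then \<phi> g else 0) = \<phi> (i * k + r)" .
  qed
  finally show ?thesis .
qed

lemma sum_shift_mod:
  fixes \<phi> :: "nat \<Rightarrow> 'a :: comm_monoid_add"
  assumes "l < n"
  shows "(\<Sum>g<n. \<phi> ((g + l) mod n)) = (\<Sum>g<n. \<phi> g)"
proof (rule sum.reindex_bij_witness[of _ "\<lambda>g. (g + (n - l)) mod n" "\<lambda>g. (g + l) mod n"])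
  fix g assume "g \<in> {..<n}"
  then have "(g + l + (n - l)) mod n = g" "(g + (n - l) + l) mod n = g" using assms by simp_all
  then show "((g + l) mod n + (n - l)) mod n = g" "((g + (n - l)) mod n + l) mod n = g"
    by (simp_all only: mod_add_left_eq)
qed (use assms in auto)

section \<open>Circulant Butson Hadamard matrices\<close>

locale circulant_BH =
  fixes n h :: nat and H :: "int \<Rightarrow> int \<Rightarrow> complex"
  assumes n_pos: "n > 0" and h_pos: "h > 0" and BH: "BH_matrix (integer_mod_group n) h H"
begin

abbreviation "F g l \<equiv> H (int g) (int l)"
abbreviation "x g \<equiv> F g 0"

lemma carrier: "carrier (integer_mod_group n) = {0..<int n}"
  using n_pos by (simp add: carrier_integer_mod_group)

lemma x_root:
  assumes "g < n" shows "x g ^ h = 1"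
  using BH assms n_pos by (simp add: BH_matrix_def carrier)

lemma x_mult_cnj:
  assumes "g < n" shows "x g * cnj (x g) = 1"
  by (rule root_of_unity_mult_cnj[OF x_root[OF assms] h_pos])

lemma F_shift:
  assumes "g < n" "l < n"
  shows "F ((g + l) mod n) l = x g"
proof -
  have "\<forall>g\<in>{0..<int n}. \<forall>k\<in>{0..<int n}. \<forall>l\<in>{0..<int n}.
      H ((g + l) mod int n) ((k + l) mod int n) = H g k"
    using BH unfolding BH_matrix_def carrier mult_integer_mod_group by blast
  then have "H ((int g + int l) mod int n) ((0 + int l) mod int n) = H (int g) 0"
    by (elim ballE[of _ _ "int g"] ballE[of _ _ 0] ballE[of _ _ "int l"]) (use assms n_pos in auto)
  then show ?thesis using assms by (simp add: zmod_int)
qed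

lemma F_eq_x:
  assumes "g < n" "l < n"
  shows "F g l = x ((g + (n - l)) mod n)"
  using F_shift[of "(g + (n - l)) mod n" l] assms by (simp add: mod_add_left_eq)

lemma orthogonal:
  assumes "g < n" "k < n"
  shows "(\<Sum>l<n. F g l * cnj (F k l)) = (if g = k then of_nat n else 0)"
proof -
  have "(\<Sum>l\<in>{0..<int n}. H (int g) l * cnj (H (int k) l)) = (if g = k then of_nat n else 0)"
    using BH assms by (simp add: BH_matrix_def carrier Coset.order_def)
  moreover have "{0..<int n} = int ` {..<n}"
    using image_int_atLeastLessThan[of 0 n] by (simp add: atLeast0LessThan)
  ultimately show ?thesis by (simp add: sum.reindex)
qed

text \<open>The row vector of the powers of \<open>\<alpha>\<close> is a left eigenvector of the
  matrix with eigenvalue \<open>f\<close>. Its image has squared length \<open>n * n\<close> by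
  orthogonality of the rows, and \<open>n * (f * cnj f)\<close> by the eigenvalue.\<close>

lemma character_norm:
  assumes \<alpha>: "\<alpha> ^ n = 1"
  shows "(\<Sum>g<n. x g * \<alpha> ^ g) * cnj (\<Sum>g<n. x g * \<alpha> ^ g) = of_nat n"
proof -
  define f where "f = (\<Sum>g<n. x g * \<alpha> ^ g)"
  have \<alpha>\<alpha>: "\<alpha> ^ g * cnj (\<alpha> ^ g) = 1" for g
    using root_of_unity_mult_cnj[OF \<alpha> n_pos] by (simp add: power_mult_distrib[symmetric])
  have \<alpha>_mod: "\<alpha> ^ (g mod n) = \<alpha> ^ g" for g
  proof -
    have "\<alpha> ^ g = \<alpha> ^ (n * (g div n) + g mod n)" by simp
    also have "\<dots> = \<alpha> ^ (g mod n)" by (simp only: power_add power_mult \<alpha> power_one mult_1)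
    finally show ?thesis by simp
  qed
  have eig: "(\<Sum>g<n. \<alpha> ^ g * F g l) = \<alpha> ^ l * f" if l: "l < n" for l
  proof -
    have "(\<Sum>g<n. \<alpha> ^ g * F g l) = (\<Sum>g<n. \<alpha> ^ ((g + l) mod n) * F ((g + l) mod n) l)"
      by (rule sum_shift_mod[OF l, symmetric])
    also have "\<dots> = (\<Sum>g<n. \<alpha> ^ l * (x g * \<alpha> ^ g))"
      by (rule sum.cong[OF refl]) (simp add: \<alpha>_mod F_shift l power_add mult_ac del: of_nat_add zmod_int)
    finally show ?thesis by (simp add: f_def sum_distrib_left)
  qed
  have "(\<Sum>l<n. (\<Sum>g<n. \<alpha> ^ g * F g l) * cnj (\<Sum>k<n. \<alpha> ^ k * F k l))
      = (\<Sum>l<n. \<Sum>g<n. \<Sum>k<n. \<alpha> ^ g * cnj (\<alpha> ^ k) * (F g l * cnj (F k l)))"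
    by (simp add: cnj_sum sum_product mult_ac)
  also have "\<dots> = (\<Sum>g<n. \<Sum>k<n. \<Sum>l<n. \<alpha> ^ g * cnj (\<alpha> ^ k) * (F g l * cnj (F k l)))"
    by (subst sum.swap, rule sum.cong[OF refl], rule sum.swap)
  also have "\<dots> = (\<Sum>g<n. \<Sum>k<n. if g = k then of_nat n else 0)"
  proof (intro sum.cong refl)
    fix g k assume "g \<in> {..<n}" "k \<in> {..<n}"
    then show "(\<Sum>l<n. \<alpha> ^ g * cnj (\<alpha> ^ k) * (F g l * cnj (F k l))) = (if g = k then of_nat n else 0)"
      using \<alpha>\<alpha>[of k] by (simp add: orthogonal flip: sum_distrib_left)
  qed
  also have "\<dots> = of_nat n * of_nat n" by simp
  also have "(\<Sum>l<n. (\<Sum>g<n. \<alpha> ^ g * F g l) * cnj (\<Sum>k<n. \<alpha> ^ k * F k l)) = (\<Sum>l<n. f * cnj f)"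
  proof (rule sum.cong[OF refl])
    fix l assume "l \<in> {..<n}"
    then have "(\<Sum>g<n. \<alpha> ^ g * F g l) * cnj (\<Sum>k<n. \<alpha> ^ k * F k l)
        = (\<alpha> ^ l * cnj (\<alpha> ^ l)) * (f * cnj f)" by (simp add: eig)
    then show "(\<Sum>g<n. \<alpha> ^ g * F g l) * cnj (\<Sum>k<n. \<alpha> ^ k * F k l) = f * cnj f"
      by (simp only: \<alpha>\<alpha> mult_1)
  qed
  finally show ?thesis using n_pos by (simp add: f_def)
qed

text \<open>A period \<open>d\<close> makes rows \<open>0\<close> and \<open>d\<close> coincide, so
  their inner product is \<open>n\<close> instead of 0.\<close>

lemma not_periodic:
  assumes d: "0 < d" "d < n" "d dvd n"
    and periodic: "\<And>g g'. g < n \<Longrightarrow> g' < n \<Longrightarrow> g mod d = g' mod d \<Longrightarrow> x g = x g'"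
  shows False
proof -
  have "F 0 l * cnj (F d l) = 1" if l: "l < n" for l
  proof -
    let ?g = "(0 + (n - l)) mod n" and ?g' = "(d + (n - l)) mod n"
    have "?g mod d = ?g' mod d" using d(3) by (simp add: mod_mod_cancel)
    then have "x ?g = x ?g'" using n_pos by (intro periodic) auto
    then show ?thesis
      using x_mult_cnj[of ?g'] F_eq_x[of 0 l] F_eq_x[of d l] d l n_pos by simp
  qed
  then have "(\<Sum>l<n. F 0 l * cnj (F d l)) = of_nat n" by simp
  then show False using orthogonal[of 0 d] d n_pos by simp
qed

end

theorem theorem3p3:
  fixes n h p :: nat
  assumes "n > 0" and "h > 0"
    and "\<exists>H. BH_matrix (integer_mod_group n) h H"
    and "prime p" and "p dvd n" and "self_conjugate p (lcm n h)"
  shows "p dvd h"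
proof (rule ccontr)
  assume p_h: "\<not> p dvd h"
  obtain H where H: "BH_matrix (integer_mod_group n) h H" using assms(3) by blast
  interpret circulant_BH n h H by standard (use assms H in auto)
  obtain a N j where lcm: "lcm n h = p ^ a * N" and coprime_N: "coprime p N"
    and j: "[int p ^ j = - 1] (mod int N)"
    using assms(6) unfolding self_conjugate_def by blast
  have coprime_h: "coprime p h" using assms(4) p_h by (simp add: prime_imp_coprime)
  have N_pos: "N > 0" using lcm assms(1,2) by (metis lcm_pos_nat mult_0_right not_gr_zero)
  have a_pos: "a > 0"
  proof (rule ccontr)
    assume "\<not> a > 0"
    then have "p dvd N" using assms(5) lcm by (metis dvd_lcm1 dvd_trans mult_1 not_gr_zero power_0)
    then show False using coprime_N assms(4) by (metis coprime_absorb_left not_prime_unit)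
  qed
  have "h dvd p ^ a * N" using lcm by (metis dvd_lcm2)
  then have h_N: "h dvd N" using coprime_h by (metis coprime_commute coprime_dvd_mult_right_iff coprime_power_left_iff)
  \<comment> \<open>Since \<open>h\<close> is prime to \<open>p\<close>, the whole factor
    \<open>p ^ a\<close> of the lcm comes from \<open>n\<close>.\<close>
  have "p ^ a dvd lcm n h" using lcm by simp
  also have "lcm n h dvd n * h" by simp
  finally have "p ^ a dvd n" using coprime_h by (simp add: coprime_dvd_mult_left_iff)
  then obtain n' where n: "n = p ^ a * n'" by (elim dvdE)
  have n'_pos: "n' > 0" using n assms(1) by simp
  have n_m: "n dvd p ^ a * N" using lcm by (metis dvd_lcm1)
  then have "n' dvd N" using n prime_gt_0_nat[OF assms(4)] by simp
  then have coprime_n': "coprime n' p" using coprime_N coprime_divisors[OF _ dvd_refl] by (simp add: coprime_commute)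
  have N_dvd: "N dvd p ^ j + 1"
  proof -
    have "int N dvd int p ^ j - (- 1)" using j by (simp add: cong_iff_dvd_diff)
    moreover have "int p ^ j - (- 1) = int (p ^ j + 1)" by simp
    ultimately have "int N dvd int (p ^ j + 1)" by (simp only:)
    then show ?thesis by (simp only: of_nat_dvd_iff)
  qed
  \<comment> \<open>The exponent 0 is possible only for \<open>N\<close> equal to 1 or 2, and then
    exponent 1 serves as well, \<open>p\<close> being odd if \<open>N = 2\<close>.\<close>
  obtain j' where j': "j' > 0" "N dvd p ^ j' + 1"
  proof (cases "j = 0")
    case False
    then show thesis using N_dvd by (intro that[of j]) auto
  next
    case True
    then have "N dvd 2" using N_dvd by (simp add: numeral_2_eq_2)
    then have "N \<le> 2" using dvd_imp_le by simp
    with N_pos consider "N = 1" | "N = 2" by linarith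
    then have "N dvd p ^ 1 + 1"
    proof cases
      case 2
      then have "odd p" using coprime_N coprime_right_2_iff_odd by blast
      then show ?thesis by (simp add: 2)
    qed simp
    then show thesis by (rule that[of 1, rotated]) simp
  qed
  interpret self_conjugate_prime p a N j' h
    by standard (use assms(4) a_pos N_pos coprime_N j' h_N in auto)
  let ?f = "\<lambda>\<alpha>. \<Sum>g<n. x g * \<alpha> ^ g"
  have x_m: "x g \<in> cyclotomic_ints m" if "g < n" for g
    using cyclotomic_ints_root[OF x_root[OF that]] cyclotomic_ints_mono[OF h_dvd_m] by blast
  have root_m: "\<alpha> \<in> cyclotomic_ints m" if "\<alpha> ^ n = 1" for \<alpha>
    using cyclotomic_ints_root[OF that] cyclotomic_ints_mono[OF n_m] by blast
  \<comment> \<open>At \<open>\<alpha> = 1\<close> the sum involves only \<open>h\<close>-th roots,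
    where the Frobenius congruence holds modulo \<open>p\<close> itself. So \<open>p\<close> divides
    \<open>?f 1\<close>, and \<open>n = ?f 1 * cnj (?f 1)\<close> acquires a second factor
    \<open>p\<close>.\<close>
  have "cyc_dvd m (of_nat p) (of_nat n)"
    using assms(1,5) by (intro cyc_dvdI[OF cyclotomic_ints_of_nat[of "n div p"]])
      (simp flip: of_nat_mult)
  then have "cyc_dvd m (of_nat p) (?f 1 * cnj (?f 1))"
    using character_norm[of 1] by simp
  moreover have "?f 1 \<in> cyclotomic_ints h"
    by (rule cyclotomic_ints_sum, rule cyclotomic_ints_root) (use x_root in simp)
  ultimately have "cyc_dvd m (of_nat p) (?f 1)" by (rule cyc_dvd_prime_if_norm[rotated])
  then obtain t where t: "t \<in> cyclotomic_ints m" "?f 1 = of_nat p * t" by (rule cyc_dvdE)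
  have p2: "cyc_dvd m (of_nat p ^ 2) (of_nat n)"
  proof (rule cyc_dvdI)
    show "t * cnj t \<in> cyclotomic_ints m" using t(1) by (intro cyclotomic_ints_mult cyclotomic_ints_cnj)
    have "of_nat n = (of_nat p * t) * cnj (of_nat p * t)"
      using character_norm[of 1] unfolding t(2) by simp
    then show "of_nat n = of_nat p ^ 2 * (t * cnj t)" by (simp add: power2_eq_square mult_ac)
  qed
  have f_dvd: "cyc_dvd m (\<pi> ^ e) (?f \<alpha>)" if "\<alpha> ^ n = 1" for \<alpha>
  proof (rule cyc_dvd_pi_power_if_norm)
    have "x g * \<alpha> ^ g \<in> cyclotomic_ints m" if "g < n" for g
      by (rule cyclotomic_ints_mult[OF x_m[OF that] cyclotomic_ints_power[OF root_m[OF \<open>\<alpha> ^ n = 1\<close>]]])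
    then show "?f \<alpha> \<in> cyclotomic_ints m" by (intro cyclotomic_ints_sum) simp
    show "cyc_dvd m (of_nat p ^ 2) (?f \<alpha> * cnj (?f \<alpha>))"
      using p2 by (simp only: character_norm[OF that])
  qed
  \<comment> \<open>The numbers \<open>\<theta> * \<eta> ^ t\<close> for \<open>t < n'\<close> are
    exactly the \<open>n'\<close>-th roots of \<open>\<zeta>\<close>; the averaging runs over
    them.\<close>
  define \<theta> where "\<theta> = cis (2 * pi / real n)"
  define \<eta> where "\<eta> = cis (2 * pi / real n')"
  have \<theta>_n: "\<theta> ^ n = 1" unfolding \<theta>_def by (rule cis_power_order[OF assms(1)])
  have \<eta>_n': "\<eta> ^ n' = 1" unfolding \<eta>_def by (rule cis_power_order[OF n'_pos])
  have \<eta>_n: "\<eta> ^ n = 1" unfolding n mult.commute[of _ n'] by (simp only: power_mult \<eta>_n' power_one)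
  have \<theta>_n': "\<theta> ^ n' = \<zeta>"
    using n'_pos p_gt_1 by (simp add: \<theta>_def \<zeta>_def Complex.DeMoivre n)
  have \<theta>_m: "\<theta> \<in> cyclotomic_ints m" by (rule root_m[OF \<theta>_n])
  have \<eta>_m: "\<eta> \<in> cyclotomic_ints m" by (rule root_m[OF \<eta>_n])
  have kr: "k * n' + r < n" if "k < p ^ a" "r < n'" for k r
  proof -
    have "k * n' + r < Suc k * n'" using that(2) by simp
    also have "\<dots> \<le> p ^ a * n'" using that(1) by (intro mult_le_mono1) simp
    finally show ?thesis by (simp add: n)
  qed
  have y_dvd: "cyc_dvd m (\<pi> ^ e) (\<Sum>k<p ^ a. x (k * n' + r) * \<zeta> ^ k)" if r: "r < n'" for r
  proof -
    let ?Y = "\<Sum>k<p ^ a. x (k * n' + r) * \<zeta> ^ k"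
    have \<eta>_comm: "(\<eta> ^ t) ^ i = (\<eta> ^ i) ^ t" for t i
      by (simp only: power_mult[symmetric] mult.commute)
    \<comment> \<open>The weight is \<open>\<eta> ^ (- r * t)\<close>, with \<open>n' - r\<close> as
      a natural exponent for \<open>- r\<close>; summing over \<open>t\<close> keeps the indices
      \<open>g\<close> congruent to \<open>r\<close> modulo \<open>n'\<close>.\<close>
    have "(\<Sum>t<n'. (\<eta> ^ t) ^ (n' - r) * ?f (\<theta> * \<eta> ^ t))
        = (\<Sum>g<n. \<Sum>t<n'. (\<eta> ^ t) ^ (n' - r) * (x g * (\<theta> * \<eta> ^ t) ^ g))"
      unfolding sum_distrib_left by (rule sum.swap)
    also have "\<dots> = (\<Sum>g<n. \<Sum>t<n'. (\<eta> ^ (g + (n' - r))) ^ t * (x g * \<theta> ^ g))"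
    proof (intro sum.cong refl)
      fix g t
      have "(\<eta> ^ t) ^ (n' - r) * (x g * (\<theta> * \<eta> ^ t) ^ g)
          = ((\<eta> ^ t) ^ g * (\<eta> ^ t) ^ (n' - r)) * (x g * \<theta> ^ g)"
        by (simp only: power_mult_distrib mult_ac)
      also have "(\<eta> ^ t) ^ g * (\<eta> ^ t) ^ (n' - r) = (\<eta> ^ (g + (n' - r))) ^ t"
        unfolding power_add[symmetric] by (rule \<eta>_comm)
      finally show "(\<eta> ^ t) ^ (n' - r) * (x g * (\<theta> * \<eta> ^ t) ^ g)
          = (\<eta> ^ (g + (n' - r))) ^ t * (x g * \<theta> ^ g)" .
    qed
    also have "\<dots> = (\<Sum>g<n. if g mod n' = r then of_nat n' * (x g * \<theta> ^ g) else 0)"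
    proof (rule sum.cong[OF refl])
      fix g
      have "n' dvd g + (n' - r) \<longleftrightarrow> g mod n' = r"
      proof -
        have "n' dvd g + (n' - r) \<longleftrightarrow> int n' dvd int (g + (n' - r))"
          by (simp only: of_nat_dvd_iff)
        also have "int (g + (n' - r)) = int g - int r + int n'" using r by simp
        also have "int n' dvd \<dots> \<longleftrightarrow> int n' dvd int g - int r" by simp
        also have "\<dots> \<longleftrightarrow> int g mod int n' = int r mod int n'" by (simp add: mod_eq_dvd_iff)
        also have "\<dots> \<longleftrightarrow> g mod n' = r" using r by (simp flip: zmod_int)
        finally show ?thesis .
      qed
      then show "(\<Sum>t<n'. (\<eta> ^ (g + (n' - r))) ^ t * (x g * \<theta> ^ g))
          = (if g mod n' = r then of_nat n' * (x g * \<theta> ^ g) else 0)"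
        unfolding sum_distrib_right[symmetric] \<eta>_def sum_roots_of_unity_powers[OF n'_pos] by simp
    qed
    also have "\<dots> = (\<Sum>k<p ^ a. of_nat n' * (x (k * n' + r) * \<theta> ^ (k * n' + r)))"
      unfolding n by (rule sum_residue_class[OF r])
    also have "\<dots> = of_nat n' * (\<theta> ^ r * ?Y)"
    proof -
      have "\<theta> ^ (k * n' + r) = \<theta> ^ r * \<zeta> ^ k" for k
        by (simp only: power_add mult.commute[of k] power_mult \<theta>_n') (rule mult.commute)
      then show ?thesis by (simp add: sum_distrib_left mult_ac)
    qed
    finally have sum_eq: "(\<Sum>t<n'. (\<eta> ^ t) ^ (n' - r) * ?f (\<theta> * \<eta> ^ t)) = of_nat n' * (\<theta> ^ r * ?Y)" .
    have "cyc_dvd m (\<pi> ^ e) (\<Sum>t<n'. (\<eta> ^ t) ^ (n' - r) * ?f (\<theta> * \<eta> ^ t))"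
    proof (rule cyc_dvd_sum)
      fix t
      have "(\<theta> * \<eta> ^ t) ^ n = \<theta> ^ n * (\<eta> ^ n) ^ t"
        by (simp only: power_mult_distrib power_mult[symmetric] mult.commute)
      then have "(\<theta> * \<eta> ^ t) ^ n = 1" by (simp add: \<theta>_n \<eta>_n)
      then show "cyc_dvd m (\<pi> ^ e) ((\<eta> ^ t) ^ (n' - r) * ?f (\<theta> * \<eta> ^ t))"
        by (rule cyc_dvd_mult_left[OF f_dvd cyclotomic_ints_power[OF cyclotomic_ints_power[OF \<eta>_m]]])
    qed
    then have n'_dvd: "cyc_dvd m (\<pi> ^ e) (of_nat n' * (\<theta> ^ r * ?Y))" by (simp only: sum_eq)
    have "?Y \<in> cyclotomic_ints m"
      by (intro cyclotomic_ints_sum cyclotomic_ints_mult cyclotomic_ints_power zeta_int x_m kr r) simp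
    then have "\<theta> ^ r * ?Y \<in> cyclotomic_ints m"
      by (rule cyclotomic_ints_mult[OF cyclotomic_ints_power[OF \<theta>_m]])
    \<comment> \<open>The factor \<open>n'\<close> is removed because it is prime to
      \<open>p\<close>, then the unit \<open>\<theta> ^ r\<close> by its inverse
      \<open>\<theta> ^ (n - r)\<close>.\<close>
    then have "cyc_dvd m (\<pi> ^ e) (of_nat p * (\<theta> ^ r * ?Y))"
      by (rule cyc_dvd_mult[OF cyc_dvd_pi_power_prime])
    then have "cyc_dvd m (\<pi> ^ e) (\<theta> ^ r * ?Y)"
      by (rule cyc_dvd_coprime[OF coprime_n' n'_dvd])
    then have "cyc_dvd m (\<pi> ^ e) (\<theta> ^ (n - r) * (\<theta> ^ r * ?Y))"
      by (rule cyc_dvd_mult_left[OF _ cyclotomic_ints_power[OF \<theta>_m]])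
    moreover have "\<theta> ^ (n - r) * \<theta> ^ r = 1"
      using kr[of 0 r] r p_gt_1 \<theta>_n by (simp flip: power_add)
    ultimately show ?thesis by (simp add: mult.assoc[symmetric])
  qed
  have n_pq: "n = p * (n' * q)" by (simp add: n p_pow_a)
  show False
  proof (rule not_periodic[of "n' * q"])
    show "0 < n' * q" using n'_pos p_gt_1 by simp
    then show "n' * q < n" using p_gt_1 by (simp add: n_pq)
    show "n' * q dvd n" by (simp add: n_pq)
    fix g g' assume g: "g < n" and g': "g' < n" and gg': "g mod (n' * q) = g' mod (n' * q)"
    have r: "g mod n' = g' mod n'"
      using arg_cong[OF gg', of "\<lambda>i. i mod n'"] by (simp add: mod_mod_cancel)
    have k: "(g div n') mod q = (g' div n') mod q"
      using gg' r n'_pos by (simp add: mod_mult2_eq)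
    \<comment> \<open>The representative on the right depends only on \<open>g mod n'\<close> and
      \<open>(g div n') mod q\<close>, both determined by \<open>g mod (n' * q)\<close>.\<close>
    have eq: "x g = x ((e + (g div n') mod q) * n' + g mod n')" if "g < n" for g
    proof -
      have r: "g mod n' < n'" using n'_pos by simp
      have "g div n' < p ^ a" using that n'_pos by (simp add: n less_mult_imp_div_less)
      from coeffs_periodic[of "\<lambda>k. x (k * n' + g mod n')", OF x_root[OF kr[OF _ r]] y_dvd[OF r] this]
      show ?thesis using n'_pos by simp
    qed
    show "x g = x g'" using eq[OF g] eq[OF g'] by (simp only: r k)
  qed
qed

end
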